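(* Let $\alpha\in\mathbb{R}\setminus\mathbb{Q}$. Then the (possibly only formal) power series \[ F_{1,1}^{(\alpha)}(z)=\sum_{n=0}^\infty \frac{z^n}{n!^{\alpha}} \] is not holonomic ($D$-finite), and consequently the sequence $(n!^{\alpha})_{n\ge0}$ is not holonomic.
   Context: Here $n!^\alpha$ means $(n!)^\alpha$, the positive real power of $n!$. An analytic function or formal power series is called holonomic (or $D$-finite) if it satisfies a (nontrivial) linear ordinary differential equation with polynomial coefficients. Equivalently, its sequence of power series coefficients satisfies a (nontrivial) linear recurrence with polynomial coefficients: there are $d\ge0$ and polynomials $p_0,\dots,p_d\in\mathbb{C}[n]$, not all zero, with $p_0(n)c_n+\dots+p_d(n)c_{n+d}=0$ for all $n\ge0$. A sequence $(c_n)_{n\ge0}$ is called holonomic if it satisfies such a recurrence. *)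

theory Defs
  imports Complex_Main "HOL-Computational_Algebra.Computational_Algebra"
begin

definition holonomic_fps :: "complex fps \<Rightarrow> bool" where
  "holonomic_fps F \<longleftrightarrow>
     (\<exists>(r :: nat) (q :: nat \<Rightarrow> complex poly).
        (\<exists>i\<le>r. q i \<noteq> 0) \<and>
        (\<Sum>i\<le>r. fps_of_poly (q i) * (fps_deriv ^^ i) F) = 0)"

definition holonomic_seq :: "(nat \<Rightarrow> complex) \<Rightarrow> bool" where
  "holonomic_seq c \<longleftrightarrow>
     (\<exists>(d :: nat) (p :: nat \<Rightarrow> complex poly).
        (\<exists>j\<le>d. p j \<noteq> 0) \<and>
        (\<forall>n. (\<Sum>j\<le>d. poly (p j) (of_nat n) * c (n + j)) = 0))"

definition F11 :: "real \<Rightarrow> complex fps" where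
  "F11 \<alpha> = Abs_fps (\<lambda>n. complex_of_real (1 / (fact n) powr \<alpha>))"

end

theory Submission
  imports Defs
begin

text \<open>
  Everything is decided by orders of growth. Write \<open>\<beta>\<close> for \<open>\<alpha>\<close> or \<open>- \<alpha>\<close>. The quotient
  \<open>(n+d)!\<^sup>\<beta> / n!\<^sup>\<beta>\<close> grows like \<open>n\<close> to the power \<open>d \<beta>\<close>, so after division by \<open>n!\<^sup>\<beta>\<close> each term of a
  recurrence or of a coefficient of a differential equation is asymptotic to a nonzero constant
  times a power of \<open>n\<close> whose exponent has the form \<open>a + d \<beta>\<close> with natural numbers \<open>a\<close> and \<open>d\<close>.
  As \<open>\<beta>\<close> is irrational, the exponent determines both \<open>a\<close> and \<open>d\<close>
  (\<open>irrational_exponent_unique\<close>), and these determine the term. Hence no two terms have the same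
  order of growth, one of them dominates all others, and the sum cannot vanish for large \<open>n\<close>
  (\<open>eventually_sum_nonzero_if_distinct_orders\<close>).

  In the recurrence the terms are the \<open>p\<^sub>j(n) c\<^sub>n\<^sub>+\<^sub>j\<close> with \<open>p\<^sub>j \<noteq> 0\<close>, where \<open>a = deg p\<^sub>j\<close> and \<open>d = j\<close>.
  In the differential equation they are the contributions of the monomials
  \<open>z\<^sup>k F\<^sup>(\<^sup>i\<^sup>)\<close> to the coefficient of \<open>z\<close> to the power \<open>n + K\<close>, where \<open>a = i\<close> and \<open>d = K - k + i\<close>.
  The same domination argument applies to both.
\<close>

section \<open>Sums of terms of distinct orders of growth\<close>

text \<open>After division by the largest of the powers of \<open>n\<close>, only the term of that order survives in
  the limit.\<close>

lemma eventually_sum_nonzero_if_distinct_orders: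
  fixes f :: "'a \<Rightarrow> nat \<Rightarrow> complex" and e :: "'a \<Rightarrow> real"
  assumes "finite S" "S \<noteq> {}" "inj_on e S"
    and lim: "\<And>s. s \<in> S \<Longrightarrow> (\<lambda>n. f s n / of_real (real n powr e s)) \<longlonglongrightarrow> c s"
    and nz: "\<And>s. s \<in> S \<Longrightarrow> c s \<noteq> 0"
  shows "eventually (\<lambda>n. (\<Sum>s\<in>S. f s n) \<noteq> 0) sequentially"
proof -
  have "Max (e ` S) \<in> e ` S"
    using assms by (intro Max_in) auto
  then obtain s0 where s0: "s0 \<in> S" "e s0 = Max (e ` S)"
    by auto
  have "(\<lambda>n. f s n / of_real (real n powr e s0)) \<longlonglongrightarrow> (if s = s0 then c s0 else 0)"
    if s: "s \<in> S" for s
  proof (cases "s = s0")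
    case True
    then show ?thesis using lim[OF s] by simp
  next
    case False
    have "e s \<le> e s0"
      using assms(1) s s0 by simp
    moreover have "e s \<noteq> e s0"
      using False assms(3) s s0(1) by (auto dest: inj_onD)
    ultimately have "e s - e s0 < 0" by simp
    then have "(\<lambda>n. real n powr (e s - e s0)) \<longlonglongrightarrow> 0"
      by (intro tendsto_neg_powr filterlim_real_sequentially)
    then have "(\<lambda>n. complex_of_real (real n powr (e s - e s0))) \<longlonglongrightarrow> of_real 0"
      by (rule tendsto_of_real)
    from tendsto_mult[OF lim[OF s] this]
    have "(\<lambda>n. f s n / of_real (real n powr e s) * of_real (real n powr (e s - e s0))) \<longlonglongrightarrow> 0"
      by simp
    then have "(\<lambda>n. f s n / of_real (real n powr e s0)) \<longlonglongrightarrow> 0"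
    proof (rule Lim_transform_eventually)
      show "\<forall>\<^sub>F n in sequentially.
          f s n / of_real (real n powr e s) * of_real (real n powr (e s - e s0))
            = f s n / of_real (real n powr e s0)"
        using eventually_gt_at_top[of 0]
        by eventually_elim (simp add: powr_diff)
    qed
    then show ?thesis using False by simp
  qed
  then have "(\<lambda>n. \<Sum>s\<in>S. f s n / of_real (real n powr e s0))
      \<longlonglongrightarrow> (\<Sum>s\<in>S. if s = s0 then c s0 else 0)"
    by (rule tendsto_sum)
  moreover have "(\<Sum>s\<in>S. if s = s0 then c s0 else 0) = c s0"
    using assms(1) s0(1) by simp
  ultimately have "(\<lambda>n. (\<Sum>s\<in>S. f s n) / of_real (real n powr e s0)) \<longlonglongrightarrow> c s0"
    by (simp add: sum_divide_distrib)
  from tendsto_imp_eventually_ne[OF this nz[OF s0(1)]] show ?thesis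
    by eventually_elim auto
qed

lemma irrational_exponent_unique:
  fixes \<beta> :: real and a b c d :: nat
  assumes "\<beta> \<notin> \<rat>" and eq: "real a + real c * \<beta> = real b + real d * \<beta>"
  shows "a = b \<and> c = d"
proof -
  have "c = d"
  proof (rule ccontr)
    assume "c \<noteq> d"
    then have "\<beta> = (real b - real a) / (real c - real d)"
      using eq by (simp add: field_simps)
    also have "\<dots> \<in> \<rat>" by (intro Rats_divide Rats_diff Rats_of_nat)
    finally show False using assms(1) by simp
  qed
  then show ?thesis using eq by simp
qed

section \<open>Growth of factorial quotients and polynomials\<close>

lemma fact_quotient_asymp:
  "(\<lambda>n. fact (n + d) / fact n / real n ^ d) \<longlonglongrightarrow> 1"
proof (induction d)
  case 0
  then show ?case by simp
next
  case (Suc d)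
  have "(\<lambda>n. 1 + real (Suc d) * inverse (real n)) \<longlonglongrightarrow> 1 + real (Suc d) * 0"
    by (intro tendsto_intros lim_inverse_n)
  from tendsto_mult[OF Suc.IH this]
  have "(\<lambda>n. fact (n + d) / fact n / real n ^ d * (1 + real (Suc d) * inverse (real n)))
      \<longlonglongrightarrow> 1" by simp
  then show ?case
  proof (rule Lim_transform_eventually)
    show "\<forall>\<^sub>F n in sequentially.
       fact (n + d) / fact n / real n ^ d * (1 + real (Suc d) * inverse (real n))
         = fact (n + Suc d) / fact n / real n ^ Suc d"
      using eventually_gt_at_top[of 0]
      by eventually_elim (simp add: field_simps)
  qed
qed

lemma fact_powr_quotient_asymp:
  "(\<lambda>n. fact (n + d) powr \<beta> / fact n powr \<beta> / real n powr (real d * \<beta>)) \<longlonglongrightarrow> 1"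
proof -
  have "(\<lambda>n. (fact (n + d) / fact n / real n ^ d) powr \<beta>) \<longlonglongrightarrow> 1 powr \<beta>"
    by (intro tendsto_powr fact_quotient_asymp tendsto_const) simp
  then have "(\<lambda>n. (fact (n + d) / fact n / real n ^ d) powr \<beta>) \<longlonglongrightarrow> 1" by simp
  then show ?thesis
  proof (rule Lim_transform_eventually)
    show "\<forall>\<^sub>F n in sequentially. (fact (n + d) / fact n / real n ^ d) powr \<beta>
        = fact (n + d) powr \<beta> / fact n powr \<beta> / real n powr (real d * \<beta>)"
      using eventually_gt_at_top[of 0]
      by eventually_elim (simp add: powr_divide powr_mult powr_powr flip: powr_realpow)
  qed
qed

lemma shifted_fact_quotient_asymp:
  "(\<lambda>n. fact (n + b + i) / fact (n + b) / real n ^ i) \<longlonglongrightarrow> 1"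
proof -
  have "(\<lambda>n. (fact (n + (b + i)) / fact n / real n ^ (b + i))
        / (fact (n + b) / fact n / real n ^ b)) \<longlonglongrightarrow> 1 / 1"
    by (intro tendsto_divide fact_quotient_asymp) simp
  then have "(\<lambda>n. (fact (n + (b + i)) / fact n / real n ^ (b + i))
        / (fact (n + b) / fact n / real n ^ b)) \<longlonglongrightarrow> 1" by simp
  then show ?thesis
  proof (rule Lim_transform_eventually)
    show "\<forall>\<^sub>F n in sequentially. (fact (n + (b + i)) / fact n / real n ^ (b + i))
        / (fact (n + b) / fact n / real n ^ b) = fact (n + b + i) / fact (n + b) / real n ^ i"
      using eventually_gt_at_top[of 0]
      by eventually_elim (simp add: power_add add.assoc)
  qed
qed

lemma poly_of_nat_asymp:
  fixes p :: "complex poly"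
  shows "(\<lambda>n. poly p (of_nat n) / of_nat n ^ degree p) \<longlonglongrightarrow> lead_coeff p"
  by (rule filterlim_compose[OF poly_divide_tendsto_aux tendsto_of_nat])

section \<open>Sequences\<close>

theorem not_holonomic_seq_fact_powr:
  fixes \<beta> :: real
  assumes "\<beta> \<notin> \<rat>"
  shows "\<not> holonomic_seq (\<lambda>n. complex_of_real ((fact n) powr \<beta>))"
proof
  assume "holonomic_seq (\<lambda>n. complex_of_real ((fact n) powr \<beta>))"
  then obtain d p where nz: "\<exists>j\<le>d. p j \<noteq> 0"
    and rec: "\<And>n. (\<Sum>j\<le>d. poly (p j) (of_nat n) * complex_of_real (fact (n + j) powr \<beta>)) = 0"
    unfolding holonomic_seq_def by blast
  define S where "S = {j. j \<le> d \<and> p j \<noteq> 0}"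
  define e where "e j = real (degree (p j)) + real j * \<beta>" for j
  define f where "f j n = poly (p j) (of_nat n)
      * complex_of_real (fact (n + j) powr \<beta> / fact n powr \<beta>)" for j n
  have "eventually (\<lambda>n. (\<Sum>j\<in>S. f j n) \<noteq> 0) sequentially"
  proof (rule eventually_sum_nonzero_if_distinct_orders)
    show "finite S" by (simp add: S_def)
    show "S \<noteq> {}" using nz by (auto simp: S_def)
    show "inj_on e S"
      using irrational_exponent_unique[OF assms] by (auto simp: inj_on_def e_def)
    show "lead_coeff (p j) \<noteq> 0" if "j \<in> S" for j
      using that by (simp add: S_def)
    show "(\<lambda>n. f j n / of_real (real n powr e j)) \<longlonglongrightarrow> lead_coeff (p j)" for j
    proof -
      have "(\<lambda>n. poly (p j) (of_nat n) / of_nat n ^ degree (p j)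
              * of_real (fact (n + j) powr \<beta> / fact n powr \<beta> / real n powr (real j * \<beta>)))
            \<longlonglongrightarrow> lead_coeff (p j) * of_real 1"
        by (intro tendsto_mult tendsto_of_real poly_of_nat_asymp fact_powr_quotient_asymp)
      then have "(\<lambda>n. poly (p j) (of_nat n) / of_nat n ^ degree (p j)
              * of_real (fact (n + j) powr \<beta> / fact n powr \<beta> / real n powr (real j * \<beta>)))
            \<longlonglongrightarrow> lead_coeff (p j)" by simp
      then show ?thesis
      proof (rule Lim_transform_eventually)
        show "\<forall>\<^sub>F n in sequentially. poly (p j) (of_nat n) / of_nat n ^ degree (p j)
              * of_real (fact (n + j) powr \<beta> / fact n powr \<beta> / real n powr (real j * \<beta>))
            = f j n / of_real (real n powr e j)"
          using eventually_gt_at_top[of 0]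
          by eventually_elim (simp add: f_def e_def powr_add powr_realpow)
      qed
    qed
  qed
  moreover have "(\<Sum>j\<in>S. f j n) = 0" for n
  proof -
    have "(\<Sum>j\<in>S. f j n) = (\<Sum>j\<le>d. f j n)"
      by (rule sum.mono_neutral_left) (auto simp: S_def f_def)
    also have "\<dots> = (\<Sum>j\<le>d. poly (p j) (of_nat n) * complex_of_real (fact (n + j) powr \<beta>))
        / complex_of_real (fact n powr \<beta>)"
      by (simp add: f_def sum_divide_distrib)
    finally show ?thesis using rec by simp
  qed
  ultimately show False by simp
qed

section \<open>Power series\<close>

lemma fps_nth_funpow_deriv:
  fixes F :: "complex fps"
  shows "((fps_deriv ^^ i) F) $ n = of_real (fact (n + i) / fact n) * F $ (n + i)"
proof (induction i arbitrary: n)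
  case 0
  then show ?case by simp
next
  case (Suc i)
  have "((fps_deriv ^^ Suc i) F) $ n = of_nat (Suc n) * ((fps_deriv ^^ i) F) $ Suc n"
    by simp
  also have "\<dots> = of_nat (Suc n) * (of_real (fact (Suc n + i) / fact (Suc n)) * F $ (Suc n + i))"
    by (simp only: Suc.IH)
  also have "\<dots> = of_real (fact (n + Suc i) / fact n) * F $ (n + Suc i)"
    by (simp add: divide_simps del: of_nat_Suc)
  finally show ?case .
qed

text \<open>The coefficient is taken at \<open>n + K\<close>, where \<open>K\<close> bounds the degree of \<open>q\<close>, so that every
  coefficient of \<open>q\<close> takes part for every \<open>n\<close>.\<close>

lemma fps_nth_poly_times_deriv:
  fixes F :: "complex fps"
  assumes "degree q \<le> K"
  shows "(fps_of_poly q * (fps_deriv ^^ i) F) $ (n + K) =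
    (\<Sum>k\<le>K. coeff q k * (of_real (fact (n + (K - k) + i) / fact (n + (K - k)))
        * F $ (n + (K - k + i))))"
proof -
  have "(fps_of_poly q * (fps_deriv ^^ i) F) $ (n + K) =
      (\<Sum>k\<le>n + K. coeff q k * ((fps_deriv ^^ i) F) $ (n + K - k))"
    by (simp add: fps_mult_nth atLeast0AtMost)
  also have "\<dots> = (\<Sum>k\<le>K. coeff q k * ((fps_deriv ^^ i) F) $ (n + K - k))"
    using assms by (intro sum.mono_neutral_right) (auto simp: coeff_eq_0)
  also have "\<dots> = (\<Sum>k\<le>K. coeff q k * (of_real (fact (n + (K - k) + i) / fact (n + (K - k)))
        * F $ (n + (K - k + i))))"
    by (intro sum.cong refl) (simp add: fps_nth_funpow_deriv add.assoc)
  finally show ?thesis .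
qed

theorem not_holonomic_fps_fact_powr:
  fixes \<beta> :: real
  assumes "\<beta> \<notin> \<rat>"
  shows "\<not> holonomic_fps (Abs_fps (\<lambda>n. complex_of_real ((fact n) powr \<beta>)))"
proof
  define F where "F = Abs_fps (\<lambda>n. complex_of_real ((fact n) powr \<beta>))"
  assume "holonomic_fps (Abs_fps (\<lambda>n. complex_of_real ((fact n) powr \<beta>)))"
  then obtain r q where nz: "\<exists>i\<le>r. q i \<noteq> 0"
    and ode: "(\<Sum>i\<le>r. fps_of_poly (q i) * (fps_deriv ^^ i) F) = 0"
    unfolding holonomic_fps_def F_def by blast
  define K where "K = Max ((\<lambda>i. degree (q i)) ` {..r})"
  have K: "degree (q i) \<le> K" if "i \<le> r" for i
    using that by (auto simp: K_def intro!: Max_ge)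
  define S where "S = {(i, k) \<in> {..r} \<times> {..K}. coeff (q i) k \<noteq> 0}"
  define e where "e = (\<lambda>(i, k). real i + real (K - k + i) * \<beta>)"
  define f where "f = (\<lambda>(i, k) n. coeff (q i) k
      * complex_of_real (fact (n + (K - k) + i) / fact (n + (K - k))
          * (fact (n + (K - k + i)) powr \<beta> / fact n powr \<beta>)))"
  have "eventually (\<lambda>n. (\<Sum>s\<in>S. f s n) \<noteq> 0) sequentially"
  proof (rule eventually_sum_nonzero_if_distinct_orders)
    show "finite S"
      by (rule finite_subset[of _ "{..r} \<times> {..K}"]) (auto simp: S_def)
    obtain i where i: "i \<le> r" "q i \<noteq> 0" using nz by blast
    then have "(i, degree (q i)) \<in> S" using K by (simp add: S_def)
    then show "S \<noteq> {}" by blast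
    show "inj_on e S"
    proof (rule inj_onI)
      fix s t assume st: "s \<in> S" "t \<in> S" "e s = e t"
      obtain i k j l where ij: "s = (i, k)" "t = (j, l)" by fastforce
      have "i = j \<and> K - k + i = K - l + j"
        using irrational_exponent_unique[OF assms] st(3) by (simp only: e_def ij prod.case)
      moreover have "k \<le> K" "l \<le> K" using st ij by (auto simp: S_def)
      ultimately show "s = t" using ij by auto
    qed
    show "(\<lambda>(i, k). coeff (q i) k) s \<noteq> 0" if "s \<in> S" for s
      using that by (auto simp: S_def)
    show "(\<lambda>n. f s n / of_real (real n powr e s)) \<longlonglongrightarrow> (\<lambda>(i, k). coeff (q i) k) s" for s
    proof (cases s)
      case (Pair i k)
      define G where "G n = fact (n + (K - k) + i) / fact (n + (K - k)) / real n ^ i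
            * (fact (n + (K - k + i)) powr \<beta> / fact n powr \<beta>
                / real n powr (real (K - k + i) * \<beta>))" for n
      have "G \<longlonglongrightarrow> 1 * 1"
        unfolding G_def
        by (intro tendsto_mult shifted_fact_quotient_asymp fact_powr_quotient_asymp)
      then have "(\<lambda>n. coeff (q i) k * of_real (G n)) \<longlonglongrightarrow> coeff (q i) k * of_real (1 * 1)"
        by (intro tendsto_mult tendsto_const tendsto_of_real)
      then have "(\<lambda>n. coeff (q i) k * of_real (G n)) \<longlonglongrightarrow> coeff (q i) k" by simp
      then have "(\<lambda>n. f (i, k) n / of_real (real n powr e (i, k))) \<longlonglongrightarrow> coeff (q i) k"
      proof (rule Lim_transform_eventually)
        show "\<forall>\<^sub>F n in sequentially. coeff (q i) k * of_real (G n)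
            = f (i, k) n / of_real (real n powr e (i, k))"
          using eventually_gt_at_top[of 0]
        proof eventually_elim
          case (elim n)
          have "real n powr e (i, k) = real n ^ i * real n powr (real (K - k + i) * \<beta>)"
            using elim by (simp add: e_def powr_add powr_realpow)
          then show ?case by (simp add: f_def G_def)
        qed
      qed
      then show ?thesis by (simp add: Pair)
    qed
  qed
  moreover have "(\<Sum>s\<in>S. f s n) = 0" for n
  proof -
    have "(\<Sum>s\<in>S. f s n) = (\<Sum>s\<in>{..r} \<times> {..K}. f s n)"
      by (rule sum.mono_neutral_left) (auto simp: S_def f_def)
    also have "\<dots> = (\<Sum>i\<le>r. \<Sum>k\<le>K. f (i, k) n)"
      by (simp add: sum.cartesian_product)
    also have "\<dots> = (\<Sum>i\<le>r. (fps_of_poly (q i) * (fps_deriv ^^ i) F) $ (n + K)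
        / complex_of_real (fact n powr \<beta>))"
      by (intro sum.cong refl)
        (simp add: fps_nth_poly_times_deriv[OF K] f_def F_def sum_divide_distrib)
    also have "\<dots> = (\<Sum>i\<le>r. fps_of_poly (q i) * (fps_deriv ^^ i) F) $ (n + K)
        / complex_of_real (fact n powr \<beta>)"
      by (simp add: fps_sum_nth sum_divide_distrib)
    finally show ?thesis using ode by simp
  qed
  ultimately show False by simp
qed

theorem mainTheorem3:
  fixes \<alpha> :: real
  assumes "\<alpha> \<notin> \<rat>"
  shows "\<not> holonomic_fps (F11 \<alpha>) \<and>
         \<not> holonomic_seq (\<lambda>n. complex_of_real ((fact n) powr \<alpha>))"
proof
  have "- \<alpha> \<notin> \<rat>" using assms by simp
  moreover have "F11 \<alpha> = Abs_fps (\<lambda>n. complex_of_real ((fact n) powr (- \<alpha>)))"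
    by (simp add: F11_def powr_minus inverse_eq_divide)
  ultimately show "\<not> holonomic_fps (F11 \<alpha>)"
    using not_holonomic_fps_fact_powr by simp
  show "\<not> holonomic_seq (\<lambda>n. complex_of_real ((fact n) powr \<alpha>))"
    using assms by (rule not_holonomic_seq_fact_powr)
qed

end
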